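(* Let $y$ be an integer such that $p=4y^2+5y+2$ is a prime with $p\ge 5$. Let $\beta\in\{-8y-6,\ 8y+4\}$, $\mu=2p-2$, $\lambda=\mu+\beta$ and $k=4p^2-2p+\tfrac{\beta}{2}$. Then no nontrivial regular $(8p^3,k,\lambda,\mu)$-PDS exists in an Abelian group of order $8p^3$.
   Context: Let $G$ be a finite Abelian group of order $v$ with identity $e$, and $D\subseteq G$ a subset of size $k$. $D$ is a $(v,k,\lambda,\mu)$-partial difference set (PDS) in $G$ if the expressions $gh^{-1}$ with $g,h\in D$, $g\neq h$, represent each non-identity element of $D$ exactly $\lambda$ times and each non-identity element of $G$ not in $D$ exactly $\mu$ times. $D$ is regular if moreover $D^{(-1)}=D$ and $e\notin D$. A regular PDS $D$ is trivial if $D\cup\{e\}$ or $G\setminus D$ is a subgroup of $G$. The parameter $\beta$ of a PDS is $\lambda-\mu$. *)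

theory Defs
  imports "HOL-Algebra.Coset" "HOL-Computational_Algebra.Primes"
begin

definition partial_difference_set ::
  "('a, 'b) monoid_scheme \<Rightarrow> nat \<Rightarrow> nat \<Rightarrow> nat \<Rightarrow> nat \<Rightarrow> 'a set \<Rightarrow> bool" where
  "partial_difference_set G v k l m D \<longleftrightarrow>
     comm_group G \<and> finite (carrier G) \<and> order G = v \<and>
     D \<subseteq> carrier G \<and> card D = k \<and>
     (\<forall>x \<in> D - {\<one>\<^bsub>G\<^esub>}.
        card {(g, h). g \<in> D \<and> h \<in> D \<and> g \<noteq> h \<and> g \<otimes>\<^bsub>G\<^esub> inv\<^bsub>G\<^esub> h = x} = l) \<and>
     (\<forall>x \<in> carrier G - D - {\<one>\<^bsub>G\<^esub>}.
        card {(g, h). g \<in> D \<and> h \<in> D \<and> g \<noteq> h \<and> g \<otimes>\<^bsub>G\<^esub> inv\<^bsub>G\<^esub> h = x} = m)"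

definition regular_PDS ::
  "('a, 'b) monoid_scheme \<Rightarrow> nat \<Rightarrow> nat \<Rightarrow> nat \<Rightarrow> nat \<Rightarrow> 'a set \<Rightarrow> bool" where
  "regular_PDS G v k l m D \<longleftrightarrow>
     partial_difference_set G v k l m D \<and>
     (\<lambda>g. inv\<^bsub>G\<^esub> g) ` D = D \<and> \<one>\<^bsub>G\<^esub> \<notin> D"

definition trivial_PDS :: "('a, 'b) monoid_scheme \<Rightarrow> 'a set \<Rightarrow> bool" where
  "trivial_PDS G D \<longleftrightarrow>
     subgroup (D \<union> {\<one>\<^bsub>G\<^esub>}) G \<or> subgroup (carrier G - D) G"

end

theory Submission
  imports Defs "HOL-Number_Theory.Residue_Primitive_Roots" "HOL-Algebra.Sylow"
begin

text \<open>The parameters are such that \<open>\<beta>\<^sup>2 + 4 (k - \<mu>) = 16 p\<^sup>2\<close>, so the nontrivial character values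
  \<open>\<beta> / 2 \<plusminus> 2 p\<close> of \<open>D\<close> are integers. Hence every \<open>t\<close> coprime to \<open>2 p\<close> is a multiplier of \<open>D\<close>; this
  is shown without characters, by comparing for a prime \<open>q\<close> the expansion of \<open>D\<^sup>q\<close> in the group
  ring as a combination of \<open>\<one>\<close>, \<open>D\<close> and \<open>G\<close> with the Frobenius congruence \<open>D\<^sup>q \<equiv> D\<^sup>(\<^sup>q\<^sup>)\<close> modulo \<open>q\<close>.

  Let \<open>H\<close> be the Sylow 2-subgroup, of order 8, and let \<open>B\<^sub>z\<close> count the elements of \<open>D\<close> in the coset
  of \<open>H\<close> whose 8th power is \<open>z\<close>. A multiplier of order \<open>p - 1\<close> modulo \<open>p\<^sup>3\<close> and modulo \<open>p\<close> permutes the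
  cosets other than \<open>H\<close> in cycles of length exactly \<open>p - 1\<close>, and \<open>B\<close> is constant on each cycle.
  So \<open>p - 1\<close> divides the sums over \<open>z \<noteq> \<one>\<close> both of \<open>B\<^sub>z\<close> and of \<open>B\<^sub>z\<close> choose 2. Since \<open>p - 1 = (4 y + 1) (y + 1)\<close>
  and \<open>0 \<le> B\<^sub>\<one> \<le> 7\<close>, the first condition \<open>B\<^sub>\<one> \<equiv> k\<close> leaves only \<open>y = 1\<close>, \<open>\<beta> = -14\<close>, \<open>B\<^sub>\<one> = 5\<close>. There the
  sum of all \<open>B\<^sub>z\<^sup>2\<close>, which counts the quotients of elements of \<open>D\<close> lying in \<open>H\<close>, violates the second.\<close>

subsection \<open>Orbits of a cyclic action\<close>

lemma funpow_period_mult: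
  assumes "(f ^^ i) x = x"
  shows "(f ^^ (i * j)) x = x"
  by (induction j) (simp_all add: funpow_add assms)

text \<open>Strong induction on \<open>card S\<close>: the orbit of one point has exactly
  \<open>n\<close> elements, \<open>w\<close> is constant on it, and its complement in
  \<open>S\<close> is again closed under \<open>f\<close>.\<close>

lemma dvd_sum_free_cyclic_action:
  fixes w :: "'a \<Rightarrow> 'b::comm_semiring_1"
  assumes "finite S" "n > 0" "\<And>x. x \<in> S \<Longrightarrow> f x \<in> S"
    and period: "\<And>x. x \<in> S \<Longrightarrow> (f ^^ n) x = x"
    and free: "\<And>x i. x \<in> S \<Longrightarrow> 0 < i \<Longrightarrow> i < n \<Longrightarrow> (f ^^ i) x \<noteq> x"
    and invariant: "\<And>x. x \<in> S \<Longrightarrow> w (f x) = w x"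
  shows "of_nat n dvd (\<Sum>x\<in>S. w x)"
  using assms
proof (induction "card S" arbitrary: S rule: less_induct)
  case less
  show ?case
  proof (cases "S = {}")
    case False
    then obtain x where x: "x \<in> S" by blast
    define Orb where "Orb = (\<lambda>i. (f ^^ i) x) ` {..<n}"
    have iter: "(f ^^ i) x \<in> S \<and> w ((f ^^ i) x) = w x" for i
      by (induction i) (use x less.prems in auto)
    have inj: "inj_on (\<lambda>i. (f ^^ i) x) {..<n}"
    proof (rule linorder_inj_onI)
      fix i j assume ij: "i < j" "i \<in> {..<n}" "j \<in> {..<n}"
      show "(f ^^ i) x \<noteq> (f ^^ j) x"
      proof
        assume "(f ^^ i) x = (f ^^ j) x"
        then have "(f ^^ (j - i)) ((f ^^ i) x) = (f ^^ i) x"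
          using ij by (metis comp_apply funpow_add le_add_diff_inverse2 less_imp_le)
        then show False
          using less.prems(5)[of "(f ^^ i) x" "j - i"] iter ij by (simp add: less_imp_diff_less)
      qed
    qed auto
    have "Orb \<subseteq> S" using iter by (auto simp: Orb_def)
    have in_Orb: "(f ^^ i) x \<in> Orb" for i
    proof -
      have "(f ^^ i) x = (f ^^ (i mod n)) ((f ^^ (n * (i div n))) x)"
        by (metis funpow_add comp_apply mod_mult_div_eq mult.commute)
      also have "\<dots> = (f ^^ (i mod n)) x"
        using funpow_period_mult less.prems(4) x by metis
      finally show ?thesis using \<open>n > 0\<close> by (auto simp: Orb_def)
    qed
    have closed: "f z \<in> S - Orb" if z: "z \<in> S - Orb" for z
    proof -
      have "f z \<notin> Orb"
      proof
        assume "f z \<in> Orb"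
        then obtain i where i: "f z = (f ^^ i) x" by (auto simp: Orb_def)
        \<comment> \<open>The inverse of \<open>f\<close> on \<open>S\<close> is
          \<open>f ^^ (n - 1)\<close>, so a point mapped into the orbit already lies in it.\<close>
        have "z = (f ^^ (n - 1)) (f z)"
          using less.prems(4)[of z] z \<open>n > 0\<close>
          by (metis DiffD1 Suc_diff_1 comp_apply funpow_Suc_right)
        also have "\<dots> = (f ^^ (n - 1 + i)) x" by (simp add: i funpow_add)
        finally show False using in_Orb z by auto
      qed
      then show ?thesis using z less.prems by auto
    qed
    have "card (S - Orb) < card S"
      using in_Orb[of 0] x \<open>finite S\<close> by (intro psubset_card_mono) auto
    then have "of_nat n dvd (\<Sum>x\<in>S - Orb. w x)"
      using closed less.prems by (intro less.hyps) auto
    moreover have "(\<Sum>x\<in>Orb. w x) = of_nat n * w x"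
      using iter by (simp add: Orb_def sum.reindex[OF inj])
    moreover have "(\<Sum>x\<in>S. w x) = (\<Sum>x\<in>S - Orb. w x) + (\<Sum>x\<in>Orb. w x)"
      using \<open>Orb \<subseteq> S\<close> \<open>finite S\<close> by (rule sum.subset_diff)
    ultimately show ?thesis by (simp add: dvd_add)
  qed simp
qed

text \<open>Since \<open>q\<close> is prime, a point that is not fixed has period exactly
  \<open>q\<close>; the non-fixed points are counted by the previous lemma with weight 1.\<close>

lemma card_cong_fixpoints_prime_period:
  assumes "finite S" "prime q" "\<And>x. x \<in> S \<Longrightarrow> f x \<in> S"
    and period: "\<And>x. x \<in> S \<Longrightarrow> (f ^^ q) x = x"
  shows "[card S = card {x \<in> S. f x = x}] (mod q)"
proof -
  let ?F = "{x \<in> S. f x = x}"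
  have fix_if_power_fix: "f x = x" if i: "x \<in> S" "0 < i" "i < q" "(f ^^ i) x = x" for x i
  proof -
    have "coprime i q"
      using i \<open>prime q\<close> by (metis coprime_commute nat_dvd_not_less prime_imp_coprime)
    \<comment> \<open>Both \<open>i\<close> and \<open>q\<close> are periods of \<open>x\<close>, so
      by Bezout 1 is a period as well.\<close>
    then obtain u v where uv: "i * u = q * v + 1"
      using i(2) bezout_nat[of i q] by auto
    have "x = (f ^^ (q * v + 1)) x"
      using funpow_period_mult[OF i(4), of u] uv by simp
    also have "\<dots> = f ((f ^^ (q * v)) x)"
      by simp
    also have "\<dots> = f x"
      by (simp add: funpow_period_mult period i)
    finally show ?thesis by simp
  qed
  have closed: "f x \<in> S - ?F" if "x \<in> S - ?F" for x
  proof -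
    have "f x \<noteq> x \<and> f x \<in> S" using that assms(3) by auto
    moreover have "f (f x) \<noteq> f x"
    proof
      assume *: "f (f x) = f x"
      have "(f ^^ i) (f x) = f x" for i
        by (induction i) (simp_all add: *)
      then have "(f ^^ q) x = f x"
        using \<open>prime q\<close> by (metis funpow_swap1 Suc_diff_1 comp_apply funpow_Suc_right prime_gt_0_nat)
      then show False using period that by auto
    qed
    ultimately show ?thesis by auto
  qed
  have "of_nat q dvd (\<Sum>x\<in>S - ?F. 1 :: nat)"
    using assms closed fix_if_power_fix
    by (intro dvd_sum_free_cyclic_action[where f = f]) (auto simp: prime_gt_0_nat)
  then have "q dvd card S - card ?F"
    using \<open>finite S\<close> by (simp add: card_Diff_subset)
  moreover have "card ?F \<le> card S"
    using \<open>finite S\<close> by (intro card_mono) auto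
  ultimately show ?thesis
    by (simp add: cong_altdef_nat)
qed

subsection \<open>Words over a subset of an Abelian group\<close>

text \<open>The number of these words is the coefficient of \<open>x\<close> in \<open>D^n\<close>
  in the integral group ring; counting them replaces group ring arithmetic.\<close>

definition words :: "('a, 'b) monoid_scheme \<Rightarrow> 'a set \<Rightarrow> nat \<Rightarrow> 'a \<Rightarrow> 'a list set" where
  "words G D n x = {xs. length xs = n \<and> set xs \<subseteq> D \<and> foldr (\<otimes>\<^bsub>G\<^esub>) xs \<one>\<^bsub>G\<^esub> = x}"

lemma finite_words: "finite D \<Longrightarrow> finite (words G D n x)"
  by (rule finite_subset[OF _ finite_lists_length_eq[of D n]]) (auto simp: words_def)

context comm_group
begin

lemma foldr_mult_closed: "set xs \<subseteq> carrier G \<Longrightarrow> foldr (\<otimes>) xs \<one> \<in> carrier G"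
  by (induction xs) auto

lemma foldr_mult_snoc:
  "set xs \<subseteq> carrier G \<Longrightarrow> x \<in> carrier G \<Longrightarrow> foldr (\<otimes>) (xs @ [x]) \<one> = x \<otimes> foldr (\<otimes>) xs \<one>"
  by (induction xs) (auto simp: m_lcomm foldr_mult_closed)

lemma foldr_mult_rotate1:
  "set xs \<subseteq> carrier G \<Longrightarrow> foldr (\<otimes>) (rotate1 xs) \<one> = foldr (\<otimes>) xs \<one>"
  by (cases xs) (auto simp: foldr_mult_snoc simp del: foldr_append)

lemma funpow_mult_one: "x \<in> carrier G \<Longrightarrow> ((\<otimes>) x ^^ n) \<one> = x [^] n"
  by (induction n) (auto simp: m_comm)

lemma card_words_Suc:
  assumes "finite D" "D \<subseteq> carrier G" "x \<in> carrier G"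
  shows "card (words G D (Suc n) x) = (\<Sum>g\<in>D. card (words G D n (inv g \<otimes> x)))"
proof -
  have "words G D (Suc n) x = (\<Union>g\<in>D. (#) g ` words G D n (inv g \<otimes> x))" (is "?L = ?R")
  proof (intro equalityI subsetI)
    fix xs assume "xs \<in> ?L"
    then obtain g ys where xs: "xs = g # ys" "g \<in> D" "set ys \<subseteq> D" "length ys = n"
      "g \<otimes> foldr (\<otimes>) ys \<one> = x"
      by (auto simp: words_def length_Suc_conv)
    then have "foldr (\<otimes>) ys \<one> = inv g \<otimes> x"
      using foldr_mult_closed[of ys] assms inv_solve_left[of "foldr (\<otimes>) ys \<one>" g x] by auto
    with xs show "xs \<in> ?R" by (auto simp: words_def)
  next
    fix xs assume "xs \<in> ?R"
    then show "xs \<in> ?L" using assms by (auto simp: words_def m_assoc[symmetric])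
  qed
  also have "card \<dots> = (\<Sum>g\<in>D. card ((#) g ` words G D n (inv g \<otimes> x)))"
    using assms by (intro card_UN_disjoint) (auto simp: finite_words)
  also have "\<dots> = (\<Sum>g\<in>D. card (words G D n (inv g \<otimes> x)))"
    by (intro sum.cong card_image) (auto simp: inj_on_def)
  finally show ?thesis .
qed

text \<open>The augmentation of \<open>D^n\<close>: each word of length \<open>n\<close> over
  \<open>D\<close> has exactly one product.\<close>

lemma sum_card_words:
  assumes "finite (carrier G)" "D \<subseteq> carrier G"
  shows "(\<Sum>x\<in>carrier G. card (words G D n x)) = card D ^ n"
proof -
  have D: "finite D" using assms finite_subset by blast
  have "(\<Sum>x\<in>carrier G. card (words G D n x)) = card (\<Union>x\<in>carrier G. words G D n x)"
    using assms D by (intro card_UN_disjoint[symmetric]) (auto simp: finite_words, auto simp: words_def)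
  also have "(\<Union>x\<in>carrier G. words G D n x) = {xs. set xs \<subseteq> D \<and> length xs = n}"
    using assms foldr_mult_closed by (auto simp: words_def)
  finally show ?thesis using D by (simp add: card_lists_length_eq)
qed

text \<open>The Frobenius congruence in the group ring: rotation acts on the words of length
  \<open>q\<close>, and its fixed points are the constant words.\<close>

lemma card_words_prime_cong:
  assumes "finite D" "D \<subseteq> carrier G" "prime q"
  shows "[card (words G D q x) = card {g \<in> D. g [^] q = x}] (mod q)"
proof -
  have "[card (words G D q x) = card {xs \<in> words G D q x. rotate1 xs = xs}] (mod q)"
  proof (rule card_cong_fixpoints_prime_period)
    show "rotate1 xs \<in> words G D q x" if "xs \<in> words G D q x" for xs
      using that assms by (auto simp: words_def foldr_mult_rotate1)
    show "(rotate1 ^^ q) xs = xs" if "xs \<in> words G D q x" for xs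
      using that by (auto simp: words_def simp flip: rotate_def)
  qed (use assms in \<open>auto simp: finite_words\<close>)
  also have "{xs \<in> words G D q x. rotate1 xs = xs} = replicate q ` {g \<in> D. g [^] q = x}"
    (is "?L = ?R")
  proof (intro equalityI subsetI)
    fix xs assume xs: "xs \<in> ?L"
    with \<open>prime q\<close> have "card (set xs) = 1"
      using rotate1_fixpoint_card[of xs] by (auto simp: words_def)
    then obtain g where "set xs = {g}" by (auto simp: card_1_singleton_iff)
    with xs have "xs = replicate q g"
      by (metis (mono_tags, lifting) mem_Collect_eq replicate_length_same singletonD words_def)
    with xs assms \<open>set xs = {g}\<close> show "xs \<in> ?R"
      by (auto simp: words_def funpow_mult_one)
  next
    fix xs assume "xs \<in> ?R"
    then show "xs \<in> ?L" using assms by (auto simp: words_def funpow_mult_one)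
  qed
  also have "card \<dots> = card {g \<in> D. g [^] q = x}"
    using prime_gt_0_nat[OF \<open>prime q\<close>] by (intro card_image) (auto simp: inj_on_def)
  finally show ?thesis .
qed

section \<open>Power maps on a finite Abelian group\<close>

lemma nat_pow_cong:
  fixes n :: nat
  assumes "x \<in> carrier G" "x [^] n = \<one>" "[a = b] (mod n)"
  shows "x [^] a = x [^] b"
proof -
  have "x [^] a = x [^] (a mod n)" for a
  proof -
    have "x [^] (n * (a div n) + a mod n) = x [^] (a mod n)"
      using assms unfolding nat_pow_mult[OF assms(1), symmetric]
        nat_pow_pow[OF assms(1), symmetric] by simp
    then show ?thesis by simp
  qed
  then show ?thesis using assms(3) unfolding cong_def by metis
qed

lemma inj_on_nat_pow_coprime_order:
  assumes "finite (carrier G)" "coprime n (order G)"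
  shows "inj_on (\<lambda>x. x [^] n) (carrier G)"
proof (rule inj_onI)
  fix x y assume xy: "x \<in> carrier G" "y \<in> carrier G" "x [^] n = y [^] n"
  obtain u where u: "[n * u = 1] (mod order G)"
    using assms cong_solve_coprime_nat by auto
  have inverse: "(z [^] n) [^] u = z" if "z \<in> carrier G" for z
  proof -
    have "z [^] (n * u) = z [^] (1::nat)"
      using nat_pow_cong[OF that pow_order_eq_1[OF that]] u by blast
    then show ?thesis using that by (simp add: nat_pow_pow)
  qed
  show "x = y" using inverse xy by metis
qed

end

subsection \<open>Multipliers of partial difference sets\<close>

lemma regular_PDS_D:
  assumes "regular_PDS G v k l m D"
  shows "finite (carrier G)" "order G = v" "D \<subseteq> carrier G" "finite D" "card D = k"
    and "\<one>\<^bsub>G\<^esub> \<notin> D"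
  using assms finite_subset
  unfolding regular_PDS_def partial_difference_set_def by blast+

lemma regular_PDS_inv_closed:
  assumes "regular_PDS G v k l m D" "g \<in> D"
  shows "inv\<^bsub>G\<^esub> g \<in> D"
  using assms unfolding regular_PDS_def by blast

text \<open>Fermat's little theorem for all integers, including negative ones and multiples of
  \<open>q\<close>, because the eigenvalues \<open>r\<close> and \<open>s\<close> will serve as
  bases.\<close>

lemma int_power_prime_cong:
  fixes x :: int
  assumes "prime q"
  shows "[x ^ q = x] (mod int q)"
proof -
  define a where "a = nat (x mod int q)"
  have q: "q > 0" using assms by (rule prime_gt_0_nat)
  then have x: "[x = int a] (mod int q)" by (simp add: a_def cong_def)
  have "[a ^ q = a] (mod q)"
  proof (cases "q dvd a")
    case True
    with q show ?thesis by (simp add: cong_def mod_eq_0_iff_dvd dvd_trans[OF True dvd_power])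
  next
    case False
    have "[a * a ^ (q - 1) = a * 1] (mod q)"
      using fermat_theorem[OF assms False] by (rule cong_scalar_left)
    with q show ?thesis by (simp flip: power_Suc)
  qed
  then have "[int a ^ q = int a] (mod int q)" by (simp flip: cong_int_iff)
  with x show ?thesis by (meson cong_pow cong_sym cong_trans)
qed

context comm_group
begin

text \<open>The definition packed into one group ring identity for \<open>D D^(-1)\<close>. At the
  identity the diagonal contributes \<open>k\<close>, and the middle term vanishes because
  \<open>D\<close> omits the identity.\<close>

lemma regular_PDS_card_quotients:
  assumes D: "regular_PDS G v k l m D" and x: "x \<in> carrier G"
  shows "int (card {(g, h). g \<in> D \<and> h \<in> D \<and> g \<otimes> inv h = x}) =
    (int k - int m) * of_bool (x = \<one>) + (int l - int m) * of_bool (x \<in> D) + int m"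
proof (cases "x = \<one>")
  case True
  have "{(g, h). g \<in> D \<and> h \<in> D \<and> g \<otimes> inv h = x} = (\<lambda>g. (g, g)) ` D"
  proof -
    have "g = h" if "g \<in> D" "h \<in> D" "g \<otimes> inv h = \<one>" for g h
      using that regular_PDS_D(3)[OF D] inv_equality[of g "inv h"] by (metis inv_closed inv_inv subsetD)
    moreover have "g \<otimes> inv g = \<one>" if "g \<in> D" for g
      using that regular_PDS_D(3)[OF D] by auto
    ultimately show ?thesis using True by auto
  qed
  then have "card {(g, h). g \<in> D \<and> h \<in> D \<and> g \<otimes> inv h = x} = k"
    using regular_PDS_D(5)[OF D] by (simp add: card_image inj_on_def)
  then show ?thesis using True regular_PDS_D(6)[OF D] by simp
next
  case False
  then have "{(g, h). g \<in> D \<and> h \<in> D \<and> g \<otimes> inv h = x} =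
    {(g, h). g \<in> D \<and> h \<in> D \<and> g \<noteq> h \<and> g \<otimes> inv h = x}"
    using regular_PDS_D(3)[OF D] by auto
  then show ?thesis
    using D x False unfolding regular_PDS_def partial_difference_set_def by auto
qed

text \<open>As \<open>D\<close> is closed under inverses, the identity for \<open>D D^(-1)\<close>
  is one for \<open>D^2\<close>; a pair \<open>(g, h)\<close> is determined by
  \<open>g\<close>.\<close>

lemma regular_PDS_card_translate:
  assumes D: "regular_PDS G v k l m D" and x: "x \<in> carrier G"
  shows "int (card {g \<in> D. inv g \<otimes> x \<in> D}) =
    (int k - int m) * of_bool (x = \<one>) + (int l - int m) * of_bool (x \<in> D) + int m"
proof -
  note sub = regular_PDS_D(3)[OF D]
  have "bij_betw fst {(g, h). g \<in> D \<and> h \<in> D \<and> g \<otimes> inv h = x} {g \<in> D. inv g \<otimes> x \<in> D}"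
  proof (rule bij_betw_byWitness[where f' = "\<lambda>g. (g, inv (inv g \<otimes> x))"])
    show "\<forall>a\<in>{(g, h). g \<in> D \<and> h \<in> D \<and> g \<otimes> inv h = x}.
        (fst a, inv (inv (fst a) \<otimes> x)) = a"
      using sub by (auto simp: m_assoc[symmetric] subset_iff)
    show "fst ` {(g, h). g \<in> D \<and> h \<in> D \<and> g \<otimes> inv h = x} \<subseteq> {g \<in> D. inv g \<otimes> x \<in> D}"
      using sub regular_PDS_inv_closed[OF D] by (auto simp: m_assoc[symmetric] subset_iff)
    show "(\<lambda>g. (g, inv (inv g \<otimes> x))) ` {g \<in> D. inv g \<otimes> x \<in> D}
        \<subseteq> {(g, h). g \<in> D \<and> h \<in> D \<and> g \<otimes> inv h = x}"
      using sub regular_PDS_inv_closed[OF D] x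
      by (auto simp: m_assoc[symmetric] subset_iff)
  qed auto
  then show ?thesis
    using regular_PDS_card_quotients[OF D x] by (simp add: bij_betw_same_card)
qed

text \<open>The integers \<open>r\<close> and \<open>s\<close> are the restricted eigenvalues, i.e. the values of the
  nontrivial characters on \<open>D\<close>.\<close>

lemma regular_PDS_card_words:
  fixes r s :: int
  assumes D: "regular_PDS G v k l m D"
    and rs: "r + s = int l - int m" "r * s = int m - int k"
  obtains a b c :: int where
    "\<And>x. x \<in> carrier G \<Longrightarrow>
      int (card (words G D n x)) = a * of_bool (x = \<one>) + b * of_bool (x \<in> D) + c"
    "a + b * r = r ^ n" "a + b * s = s ^ n"
proof -
  note sub = regular_PDS_D(3)[OF D]
  have "\<exists>a b c :: int. (\<forall>x\<in>carrier G.
      int (card (words G D n x)) = a * of_bool (x = \<one>) + b * of_bool (x \<in> D) + c) \<and>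
    a + b * r = r ^ n \<and> a + b * s = s ^ n"
  proof (induction n)
    case 0
    have "words G D 0 x = (if x = \<one> then {[]} else {})" for x
      by (auto simp: words_def)
    then show ?case by (intro exI[of _ 1] exI[of _ 0]) auto
  next
    case (Suc n)
    then obtain a b c :: int where
      count: "\<And>x. x \<in> carrier G \<Longrightarrow>
        int (card (words G D n x)) = a * of_bool (x = \<one>) + b * of_bool (x \<in> D) + c"
      and ab: "a + b * r = r ^ n" "a + b * s = s ^ n" by blast
    \<comment> \<open>Coefficients of \<open>D (a + b D + c G)\<close>, using
      \<open>D^2 = (k - m) 1 + (l - m) D + m G\<close> and \<open>D G = k G\<close>.\<close>
    let ?a = "b * (int k - int m)" and ?b = "a + b * (int l - int m)"
      and ?c = "b * int m + c * int k"
    have "int (card (words G D (Suc n) x)) =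
        ?a * of_bool (x = \<one>) + ?b * of_bool (x \<in> D) + ?c" if x: "x \<in> carrier G" for x
    proof -
      have "inv g \<otimes> x = \<one> \<longleftrightarrow> g = x" if "g \<in> D" for g
        using that sub x inv_solve_left'[of \<one> g x] by auto
      then have "(\<Sum>g\<in>D. of_bool (inv g \<otimes> x = \<one>)) = (\<Sum>g\<in>D. of_bool (g = x) :: int)"
        by (intro sum.cong) auto
      then have one: "(\<Sum>g\<in>D. of_bool (inv g \<otimes> x = \<one>)) = (of_bool (x \<in> D) :: int)"
        using regular_PDS_D(4)[OF D] by (simp add: of_bool_def sum.delta)
      have two: "(\<Sum>g\<in>D. of_bool (inv g \<otimes> x \<in> D)) =
          (int k - int m) * of_bool (x = \<one>) + (int l - int m) * of_bool (x \<in> D) + int m"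
        unfolding regular_PDS_card_translate[OF D x, symmetric]
        using regular_PDS_D(4)[OF D] by (simp add: sum_of_bool_eq Int_def)
      have "int (card (words G D (Suc n) x)) =
          (\<Sum>g\<in>D. a * of_bool (inv g \<otimes> x = \<one>) + b * of_bool (inv g \<otimes> x \<in> D) + c)"
        unfolding card_words_Suc[OF regular_PDS_D(4)[OF D] sub x] of_nat_sum
        using sub x by (intro sum.cong count) auto
      also have "\<dots> = a * (\<Sum>g\<in>D. of_bool (inv g \<otimes> x = \<one>)) +
          b * (\<Sum>g\<in>D. of_bool (inv g \<otimes> x \<in> D)) + int k * c"
        by (simp only: sum.distrib sum_distrib_left sum_constant regular_PDS_D(5)[OF D] of_nat_id)
      finally show ?thesis unfolding one two by (simp add: algebra_simps)
    qed
    \<comment> \<open>Both \<open>r\<close> and \<open>s\<close> satisfy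
      \<open>t^2 = (l - m) t + (k - m)\<close>, so sending \<open>D\<close> to \<open>t\<close> and
      \<open>G\<close> to 0 respects the recursion.\<close>
    moreover have "?a + ?b * t = t ^ Suc n" if t: "a + b * t = t ^ n" "t = r \<or> t = s" for t
    proof -
      have "t * t = (r + s) * t - r * s" using t(2) by (auto simp: algebra_simps)
      then have "b * (t * t) = b * ((int l - int m) * t - (int m - int k))" by (simp only: rs)
      then have "t * (a + b * t) = ?a + ?b * t" by (simp add: algebra_simps)
      then show ?thesis using t(1) by simp
    qed
    ultimately show ?case using ab by blast
  qed
  then show ?thesis using that by blast
qed

text \<open>Modulo \<open>q\<close> the coefficients \<open>a\<close>, \<open>b\<close>,
  \<open>c\<close> of \<open>D^q\<close> become 0, 1, 0, so membership in \<open>D\<close> can be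
  read off from the number of words modulo \<open>q\<close>.\<close>

lemma regular_PDS_prime_multiplier:
  fixes r s :: int
  assumes D: "regular_PDS G v k l m D"
    and rs: "r + s = int l - int m" "r * s = int m - int k"
    and q: "prime q" "coprime q v" "coprime (int q) (r - s)"
    and g: "g \<in> D"
  shows "g [^] q \<in> D"
proof -
  note sub = regular_PDS_D(3)[OF D]
  obtain a b c :: int where
    count: "\<And>x. x \<in> carrier G \<Longrightarrow>
      int (card (words G D q x)) = a * of_bool (x = \<one>) + b * of_bool (x \<in> D) + c"
    and ab: "a + b * r = r ^ q" "a + b * s = s ^ q"
    using regular_PDS_card_words[OF D rs] by blast
  have "b * (r - s) = r ^ q - s ^ q" using ab by (simp add: algebra_simps)
  then have "[b * (r - s) = 1 * (r - s)] (mod int q)"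
    using cong_diff[OF int_power_prime_cong[OF q(1), of r] int_power_prime_cong[OF q(1), of s]]
    by simp
  then have b: "[b = 1] (mod int q)"
    using q(3) by (simp only: cong_mult_rcancel coprime_commute)
  have "[a + b * r - b * r = r - 1 * r] (mod int q)"
    unfolding ab by (intro cong_diff int_power_prime_cong cong_mult b cong_refl q)
  then have a: "[a = 0] (mod int q)" by simp
  \<comment> \<open>The eigenvalue equations do not involve \<open>c\<close>; it is found by summing
    over the whole group, where \<open>v\<close> is invertible modulo \<open>q\<close>.\<close>
  have "int k ^ q = (\<Sum>x\<in>carrier G. int (card (words G D q x)))"
    using sum_card_words[OF regular_PDS_D(1)[OF D] sub, of q] regular_PDS_D(5)[OF D]
    by (simp flip: of_nat_sum)
  also have "\<dots> = (\<Sum>x\<in>carrier G. a * of_bool (x = \<one>) + b * of_bool (x \<in> D) + c)"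
    using count by (intro sum.cong) auto
  also have "\<dots> = a + b * int k + c * int v"
  proof -
    have "(\<Sum>x\<in>carrier G. of_bool (x = \<one>)) = (1 :: int)"
      using regular_PDS_D(1)[OF D] by (simp add: of_bool_def sum.delta)
    moreover have "(\<Sum>x\<in>carrier G. of_bool (x \<in> D)) = int k"
      using regular_PDS_D(1,5)[OF D] sub by (simp add: sum_of_bool_eq Int_absorb1)
    ultimately show ?thesis
      using regular_PDS_D(2)[OF D]
      by (simp add: sum.distrib order_def flip: sum_distrib_left)
  qed
  finally have "c * int v = int k ^ q - (a + b * int k)" by simp
  also have "[\<dots> = int k - (0 + 1 * int k)] (mod int q)"
    by (intro cong_diff cong_add cong_mult a b cong_refl int_power_prime_cong q)
  finally have "[c * int v = 0 * int v] (mod int q)" by simp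
  then have c: "[c = 0] (mod int q)"
    using q(2) by (simp only: cong_mult_rcancel coprime_commute coprime_int_iff)
  have gG: "g \<in> carrier G" using g sub by auto
  have "{h \<in> D. h [^] q = g [^] q} = {g}"
    using inj_on_nat_pow_coprime_order[of q] regular_PDS_D(1,2)[OF D] q(2) g gG sub
    by (auto dest: inj_onD)
  then have "[card (words G D q (g [^] q)) = 1] (mod q)"
    using card_words_prime_cong[OF regular_PDS_D(4)[OF D] sub q(1), of "g [^] q"] by simp
  then have "[int (card (words G D q (g [^] q))) = 1] (mod int q)"
    using cong_int_iff[of _ 1 q] by simp
  moreover have "[int (card (words G D q (g [^] q))) =
      0 * of_bool (g [^] q = \<one>) + 1 * of_bool (g [^] q \<in> D) + 0] (mod int q)"
    unfolding count[OF nat_pow_closed[OF gG]]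
    by (intro cong_add cong_mult a b c cong_refl)
  ultimately have "[1 = of_bool (g [^] q \<in> D)] (mod int q)"
    by (simp add: cong_def)
  then show ?thesis
    using prime_gt_1_nat[OF q(1)] by (cases "g [^] q \<in> D") (auto simp: cong_def)
qed

text \<open>Multipliers compose, so prime factors of \<open>n\<close> can be treated one at a
  time.\<close>

lemma regular_PDS_multiplier:
  fixes r s :: int
  assumes D: "regular_PDS G v k l m D"
    and rs: "r + s = int l - int m" "r * s = int m - int k"
    and n: "n > 0" "coprime n v" "coprime (int n) (r - s)"
    and g: "g \<in> D"
  shows "g [^] n \<in> D"
  using n g
proof (induction n arbitrary: g rule: prime_divisors_induct)
  case (factor q n)
  have "g [^] q \<in> D"
    using factor by (intro regular_PDS_prime_multiplier[OF D rs]) auto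
  then have "(g [^] q) [^] n \<in> D"
    using factor by auto
  then show ?case
    using factor.prems regular_PDS_D(3)[OF D] by (auto simp: nat_pow_pow)
qed (use regular_PDS_D(3)[OF D] in auto)

end

subsection \<open>Fibres of the projection onto the \<open>p\<close>-part\<close>

text \<open>The torsion elements form a Sylow subgroup \<open>Q\<close>: if \<open>x\<close> is
  killed by \<open>q ^ a\<close>, then \<open>x [^] n\<close> lies in \<open>Q\<close> because the
  quotient has order \<open>n\<close>, and \<open>n\<close> is invertible modulo
  \<open>q ^ a\<close>.\<close>

lemma (in comm_group) card_prime_power_torsion:
  assumes fin: "finite (carrier G)" and q: "prime q" "order G = q ^ a * n" "coprime q n"
  shows "card {x \<in> carrier G. x [^] (q ^ a) = \<one>} = q ^ a"
proof -
  obtain Q where Q: "subgroup Q G" "card Q = q ^ a"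
    using sylow_thm[OF q(1) is_group q(2) fin] by blast
  interpret Q: normal Q G
    using Q(1) by (simp add: subgroup_imp_normal)
  interpret M: group "G Mod Q" by (rule Q.factorgroup_is_group)
  interpret SQ: group "G\<lparr>carrier := Q\<rparr>" by (rule subgroup.subgroup_is_group[OF Q(1) is_group])
  have "order (G Mod Q) * q ^ a = order G"
    using lagrange[OF Q(1)] Q(2) by (simp add: order_def FactGroup_def)
  then have index: "order (G Mod Q) = n"
    using q prime_gt_0_nat[of q] by simp
  have "x \<in> Q \<longleftrightarrow> x [^] (q ^ a) = \<one>" if x: "x \<in> carrier G" for x
  proof
    assume "x \<in> Q"
    then show "x [^] (q ^ a) = \<one>"
      using SQ.pow_order_eq_1[of x] Q(2) by (simp add: order_def flip: nat_pow_consistent)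
  next
    assume ord: "x [^] (q ^ a) = \<one>"
    have "Q #> (x [^] n) = (Q #> x) [^]\<^bsub>G Mod Q\<^esub> n"
      using hom_nat_pow[OF Q.r_coset_hom_Mod x is_group M.is_group] by simp
    also have "\<dots> = Q"
      using M.pow_order_eq_1[of "Q #> x"] x index
      by (auto simp: FactGroup_def RCOSETS_def)
    finally have xn: "x [^] n \<in> Q"
      using x Q(1) by (metis nat_pow_closed rcos_self)
    obtain u where u: "[n * u = 1] (mod q ^ a)"
      using q(3) cong_solve_coprime_nat[of n "q ^ a"] by (auto simp: coprime_commute)
    have "x = x [^] (n * u)"
      using nat_pow_cong[OF x ord u] x by simp
    also have "\<dots> = (x [^] n) [^] u" using x by (simp add: nat_pow_pow)
    also have "\<dots> \<in> Q"
      using xn SQ.nat_pow_closed[of "x [^] n" u] by (simp flip: nat_pow_consistent)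
    finally show "x \<in> Q" .
  qed
  then have "{x \<in> carrier G. x [^] (q ^ a) = \<one>} = Q"
    using subgroup.subset[OF Q(1)] by auto
  then show ?thesis using Q(2) by simp
qed

text \<open>Witness: a Teichmueller representative \<open>g ^ (p ^ e)\<close> of a primitive root \<open>g\<close>.\<close>

lemma odd_primitive_root_of_unity_mod_prime_power:
  fixes p :: nat
  assumes p: "prime p" "odd p"
  obtains s where "odd s" "coprime s p" "[s ^ (p - 1) = 1] (mod p ^ Suc e)"
    "\<And>i. 0 < i \<Longrightarrow> i < p - 1 \<Longrightarrow> \<not> [s ^ i = 1] (mod p)"
proof -
  obtain g0 where g0: "residue_primroot p g0"
    using prime_primitive_root_exists p prime_gt_1_nat by blast
  \<comment> \<open>Adding the odd number \<open>p\<close> corrects the parity without changing the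
    residue modulo \<open>p\<close>.\<close>
  define g where "g = (if odd g0 then g0 else g0 + p)"
  have g: "residue_primroot p g" "odd g"
    using g0 p residue_primroot_cong[of g0 "g0 + p" p] by (auto simp: g_def cong_def)
  have cop: "coprime p g" and ord: "ord p g = p - 1"
    using g(1) p by (auto simp: residue_primroot_def totient_prime)
  show thesis
  proof (rule that[of "g ^ (p ^ e)"])
    show "odd (g ^ (p ^ e))" "coprime (g ^ (p ^ e)) p"
      using g cop by (auto simp: coprime_commute)
    show "[(g ^ (p ^ e)) ^ (p - 1) = 1] (mod p ^ Suc e)"
      using euler_theorem[of g "p ^ Suc e"] cop totient_prime_power_Suc[OF p(1), of e]
      by (simp add: coprime_commute flip: power_mult)
    fix i assume i: "0 < i" "i < p - 1"
    show "\<not> [(g ^ (p ^ e)) ^ i = 1] (mod p)"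
    proof
      assume "[(g ^ (p ^ e)) ^ i = 1] (mod p)"
      then have "p - 1 dvd p ^ e * i"
        using ord_divides[of g "p ^ e * i" p] ord by (simp add: power_mult)
      \<comment> \<open>Hence raising \<open>g\<close> to the power \<open>p ^ e\<close> keeps its
        order modulo \<open>p\<close>.\<close>
      moreover have "coprime (p - 1) (p ^ e)"
        using prime_gt_0_nat[OF p(1)] coprime_diff_one_left_nat[of p] by simp
      ultimately have "p - 1 dvd i" by (simp add: coprime_dvd_mult_right_iff)
      then show False using i by (auto dest: dvd_imp_le)
    qed
  qed
qed

text \<open>The cosets of the \<open>n\<close>-torsion subgroup are labelled by the common
  \<open>n\<close>-th power of their elements, which avoids working in the quotient group.\<close>

definition fibre_size :: "('a, 'b) monoid_scheme \<Rightarrow> nat \<Rightarrow> 'a set \<Rightarrow> 'a \<Rightarrow> nat" where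
  "fibre_size G n D z = card {g \<in> D. g [^]\<^bsub>G\<^esub> n = z}"

context comm_group
begin

lemma sum_fibre_size:
  assumes "finite (carrier G)" "D \<subseteq> carrier G"
  shows "(\<Sum>z\<in>(\<lambda>x. x [^] n) ` carrier G. fibre_size G n D z) = card D"
proof -
  have D: "finite D" using assms finite_subset by blast
  have "(\<Sum>z\<in>(\<lambda>x. x [^] n) ` carrier G. fibre_size G n D z) =
      card (\<Union>z\<in>(\<lambda>x. x [^] n) ` carrier G. {g \<in> D. g [^] n = z})"
    unfolding fibre_size_def using assms D by (intro card_UN_disjoint[symmetric]) auto
  also have "(\<Union>z\<in>(\<lambda>x. x [^] n) ` carrier G. {g \<in> D. g [^] n = z}) = D"
    using assms by auto
  finally show ?thesis .
qed

lemma nat_pow_eq_iff_quotient: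
  fixes n :: nat
  assumes "g \<in> carrier G" "h \<in> carrier G"
  shows "(g \<otimes> inv h) [^] n = \<one> \<longleftrightarrow> g [^] n = h [^] n"
proof -
  have "(g \<otimes> inv h) [^] n = g [^] n \<otimes> inv (h [^] n)"
    using assms by (simp add: pow_mult_distrib m_comm nat_pow_inv)
  then show ?thesis
    using assms inv_solve_right'[of \<one> "g [^] n" "h [^] n"] by auto
qed

text \<open>Double count of the pairs in \<open>D\<close> with equal \<open>n\<close>-th powers: by
  the common power, and by their quotient, which ranges over \<open>H\<close>.\<close>

lemma regular_PDS_sum_fibre_size_square:
  fixes n :: nat
  assumes D: "regular_PDS G v k l m D"
  defines "H \<equiv> {x \<in> carrier G. x [^] n = \<one>}"
  shows "(\<Sum>z\<in>(\<lambda>x. x [^] n) ` carrier G. (int (fibre_size G n D z))\<^sup>2) =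
    int k - int m + (int l - int m) * int (card (D \<inter> H)) + int m * int (card H)"
proof -
  note sub = regular_PDS_D(3)[OF D] and fin = regular_PDS_D(1)[OF D] and finD = regular_PDS_D(4)[OF D]
  have finH: "finite H" using fin by (simp add: H_def)
  have "(\<Sum>z\<in>(\<lambda>x. x [^] n) ` carrier G. (fibre_size G n D z)\<^sup>2) =
      (\<Sum>z\<in>(\<lambda>x. x [^] n) ` carrier G. card ({g \<in> D. g [^] n = z} \<times> {g \<in> D. g [^] n = z}))"
    by (simp add: fibre_size_def card_cartesian_product power2_eq_square)
  also have "\<dots> = card (\<Union>z\<in>(\<lambda>x. x [^] n) ` carrier G.
      {g \<in> D. g [^] n = z} \<times> {g \<in> D. g [^] n = z})"
    using fin finD by (intro card_UN_disjoint[symmetric]) auto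
  also have "(\<Union>z\<in>(\<lambda>x. x [^] n) ` carrier G. {g \<in> D. g [^] n = z} \<times> {g \<in> D. g [^] n = z}) =
      (\<Union>x\<in>H. {(g, h). g \<in> D \<and> h \<in> D \<and> g \<otimes> inv h = x})"
    using sub nat_pow_eq_iff_quotient by (auto simp: H_def subset_iff image_iff)
  also have "card \<dots> = (\<Sum>x\<in>H. card {(g, h). g \<in> D \<and> h \<in> D \<and> g \<otimes> inv h = x})"
    using finH finD
    by (intro card_UN_disjoint ballI finite_subset[OF _ finite_cartesian_product[OF finD finD]]) auto
  finally have "(\<Sum>z\<in>(\<lambda>x. x [^] n) ` carrier G. (int (fibre_size G n D z))\<^sup>2) =
      (\<Sum>x\<in>H. int (card {(g, h). g \<in> D \<and> h \<in> D \<and> g \<otimes> inv h = x}))"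
    by (simp flip: of_nat_sum of_nat_power)
  also have "\<dots> = (\<Sum>x\<in>H. (int k - int m) * of_bool (x = \<one>) +
      (int l - int m) * of_bool (x \<in> D) + int m)"
    by (intro sum.cong regular_PDS_card_quotients[OF D]) (auto simp: H_def)
  also have "\<dots> = int k - int m + (int l - int m) * int (card (D \<inter> H)) + int m * int (card H)"
  proof -
    have "(\<Sum>x\<in>H. of_bool (x = \<one>)) = (1 :: int)"
      using finH by (simp add: of_bool_def sum.delta) (simp add: H_def)
    moreover have "(\<Sum>x\<in>H. of_bool (x \<in> D)) = int (card (D \<inter> H))"
      using finH by (simp add: sum_of_bool_eq Int_commute)
    ultimately show ?thesis by (simp add: sum.distrib flip: sum_distrib_left)
  qed
  finally show ?thesis .
qed

text \<open>The \<open>s\<close>-th power map permutes \<open>D\<close> and carries the fibre over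
  \<open>z\<close> onto the fibre over \<open>z [^] s\<close>.\<close>

lemma fibre_size_nat_pow:
  assumes fin: "finite (carrier G)" and sub: "D \<subseteq> carrier G"
    and s: "coprime s (order G)" "\<And>g. g \<in> D \<Longrightarrow> g [^] s \<in> D"
    and z: "z \<in> carrier G"
  shows "fibre_size G n D (z [^] s) = fibre_size G n D z"
proof -
  have inj: "inj_on (\<lambda>x. x [^] s) (carrier G)"
    using inj_on_nat_pow_coprime_order[OF fin s(1)] .
  have "(\<lambda>x. x [^] s) ` D = D"
    using fin sub s(2) inj by (intro endo_inj_surj) (auto intro: finite_subset inj_on_subset)
  have "{g \<in> D. g [^] n = z [^] s} = (\<lambda>x. x [^] s) ` {g \<in> D. g [^] n = z}"
  proof (intro equalityI subsetI)
    fix g assume g: "g \<in> {g \<in> D. g [^] n = z [^] s}"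
    then obtain h where h: "h \<in> D" "g = h [^] s"
      using \<open>(\<lambda>x. x [^] s) ` D = D\<close> by blast
    then have "(h [^] n) [^] s = z [^] s"
      using g sub by (auto simp: nat_pow_pow mult.commute)
    then have "h [^] n = z"
      using h sub z inj by (auto dest: inj_onD)
    then show "g \<in> (\<lambda>x. x [^] s) ` {g \<in> D. g [^] n = z}" using h by auto
  next
    fix g assume "g \<in> (\<lambda>x. x [^] s) ` {g \<in> D. g [^] n = z}"
    then obtain h where h: "h \<in> D" "h [^] n = z" "g = h [^] s" by blast
    then have "g [^] n = (h [^] n) [^] s"
      using sub by (auto simp: nat_pow_pow mult.commute)
    then show "g \<in> {g \<in> D. g [^] n = z [^] s}" using h s(2) by auto
  qed
  then show ?thesis
    unfolding fibre_size_def using inj sub by (auto intro!: card_image inj_on_subset[OF inj])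
qed

text \<open>The orbits of \<open>z \<mapsto> z [^] s\<close> on nontrivial labels all have length
  \<open>p - 1\<close>. The weight \<open>F\<close> stays arbitrary so that first and second moments
  are both covered.\<close>

lemma dvd_sum_fibre_size:
  fixes F :: "nat \<Rightarrow> 'c::comm_semiring_1"
  assumes fin: "finite (carrier G)" and sub: "D \<subseteq> carrier G"
    and p: "prime p" "odd p" and order: "order G = 2 ^ a * p ^ Suc e"
    and closed: "\<And>g t. g \<in> D \<Longrightarrow> coprime t (order G) \<Longrightarrow> g [^] t \<in> D"
  shows "of_nat (p - 1) dvd
    (\<Sum>z\<in>(\<lambda>x. x [^] ((2::nat) ^ a)) ` carrier G - {\<one>}. F (fibre_size G (2 ^ a) D z))"
proof -
  obtain s where s: "odd s" "coprime s p" "[s ^ (p - 1) = 1] (mod p ^ Suc e)"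
    "\<And>i. 0 < i \<Longrightarrow> i < p - 1 \<Longrightarrow> \<not> [s ^ i = 1] (mod p)"
    using odd_primitive_root_of_unity_mod_prime_power[OF p] by blast
  have cop: "coprime s (order G)"
    using s order by (simp add: coprime_right_2_iff_odd)
  let ?f = "\<lambda>z. z [^] s" and ?Z = "(\<lambda>x. x [^] ((2::nat) ^ a)) ` carrier G"
  have funpow: "(?f ^^ i) z = z [^] (s ^ i)" if "z \<in> carrier G" for z i
    using that by (induction i) (auto simp: nat_pow_pow mult.commute)
  have torsion: "z [^] (p ^ Suc e) = \<one>" if "z \<in> ?Z" for z
    using that pow_order_eq_1 by (auto simp: nat_pow_pow order)
  show ?thesis
  proof (rule dvd_sum_free_cyclic_action[where f = ?f])
    show "finite (?Z - {\<one>})" using fin by simp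
    show "p - 1 > 0" using prime_gt_1_nat[OF p(1)] by simp
    fix z assume z: "z \<in> ?Z - {\<one>}"
    then have zG: "z \<in> carrier G" by auto
    show "?f z \<in> ?Z - {\<one>}"
    proof -
      obtain x where x: "x \<in> carrier G" "z = x [^] ((2::nat) ^ a)" using z by auto
      then have "?f z = ?f x [^] ((2::nat) ^ a)" by (simp add: nat_pow_pow mult.commute)
      moreover have "?f z \<noteq> \<one>"
        using inj_onD[OF inj_on_nat_pow_coprime_order[OF fin cop], of z \<one>] z zG by auto
      ultimately show ?thesis using x by auto
    qed
    show "(?f ^^ (p - 1)) z = z"
      using nat_pow_cong[OF zG torsion s(3)] z zG by (simp add: funpow)
    show "F (fibre_size G (2 ^ a) D (?f z)) = F (fibre_size G (2 ^ a) D z)"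
      using fibre_size_nat_pow[OF fin sub cop closed[OF _ cop] zG] by simp
    fix i assume i: "0 < i" "i < p - 1"
    show "(?f ^^ i) z \<noteq> z"
    proof
      assume "(?f ^^ i) z = z"
      then have eq: "z [^] (s ^ i) = z" using funpow zG by simp
      have "s ^ i > 0" using s(1) by (auto simp: odd_pos)
      then have "z [^] (s ^ i - 1) \<otimes> z = \<one> \<otimes> z"
        using eq zG by (simp flip: nat_pow_Suc)
      then have one: "z [^] (s ^ i - 1) = \<one>"
        using zG by (metis nat_pow_closed one_closed right_cancel)
      have "\<not> p dvd s ^ i - 1"
        using s(4)[OF i] \<open>s ^ i > 0\<close> by (auto simp: cong_altdef_nat)
      \<comment> \<open>The order of \<open>z\<close> divides both numbers, so \<open>z\<close>
        would be the identity.\<close>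
      then have "coprime (s ^ i - 1) (p ^ Suc e)"
        using p(1) by (metis coprime_commute coprime_power_right_iff prime_imp_coprime)
      then have "ord z = 1"
        using one torsion[of z] z zG pow_eq_id
        by (metis DiffD1 coprime_common_divisor nat_dvd_1_iff_1)
      then show False using z zG pow_ord_eq_1[OF zG] by simp
    qed
  qed
qed

end

section \<open>Arithmetic of the parameters and the contradiction\<close>

text \<open>Here \<open>N\<close> is \<open>p - 1\<close>, and the linear terms are
  \<open>h + 2\<close> for the two values of \<open>h = \<beta> div 2\<close>. Except in the second
  case at \<open>y = 1\<close>, where \<open>-5 + 10 = 5\<close>, steps of length \<open>N\<close>
  jump over the interval from 0 to 7.\<close>

lemma no_small_residue:
  fixes y N t x :: int
  assumes N: "N = 4 * y\<^sup>2 + 5 * y + 1" and y: "y \<ge> 1 \<or> y \<le> -3" and x: "0 \<le> x" "x \<le> 7"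
  shows "x \<noteq> 4 * y + 4 + N * t"
    and "x = -4 * y - 1 + N * t \<Longrightarrow> y = 1 \<and> x = 5"
proof -
  \<comment> \<open>Linear bounds on the square, together with the trichotomy for
    \<open>N * t\<close> below, make the case analysis linear.\<close>
  have sq: "y = 1 \<and> y\<^sup>2 = 1 \<or> y \<ge> 2 \<and> y\<^sup>2 \<ge> 2 * y \<or> y \<le> -3 \<and> y\<^sup>2 \<ge> -3 * y"
  proof -
    have "2 * y \<le> y * y" if "y \<ge> 2" using that by (intro mult_right_mono) auto
    moreover have "-3 * y \<le> y * y" if "y \<le> -3" using that by (intro mult_right_mono_neg) auto
    ultimately show ?thesis using y by (cases "y = 1") (auto simp: power2_eq_square)
  qed
  then have "N \<ge> 0" using N by auto
  then have t: "N * t \<le> - N \<or> N * t = 0 \<or> N * t \<ge> N"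
    using mult_left_mono[of t "-1" N] mult_left_mono[of 1 t N] by (cases "t = 0") force+
  show "x \<noteq> 4 * y + 4 + N * t"
    using sq t N x by auto
  show "y = 1 \<and> x = 5" if eq: "x = -4 * y - 1 + N * t"
  proof -
    have "y = 1" using sq t N x eq by auto
    moreover have "x = 10 * t - 5" using eq N \<open>y = 1\<close> by simp
    ultimately show ?thesis using x by presburger
  qed
qed

theorem theorem4:
  fixes G :: "('a, 'b) monoid_scheme" and y \<beta> :: int and p k l m :: nat
  assumes "int p = 4 * y\<^sup>2 + 5 * y + 2"
    and "prime p" and "p \<ge> 5"
    and "\<beta> \<in> {- 8 * y - 6, 8 * y + 4}"
    and "int m = 2 * int p - 2"
    and "int l = int m + \<beta>"
    and "int k = 4 * (int p)\<^sup>2 - 2 * int p + \<beta> div 2"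
    and "comm_group G" and "finite (carrier G)" and "order G = 8 * p ^ 3"
  shows "\<not> (\<exists>D. regular_PDS G (8 * p ^ 3) k l m D \<and> \<not> trivial_PDS G D)"
proof
  assume "\<exists>D. regular_PDS G (8 * p ^ 3) k l m D \<and> \<not> trivial_PDS G D"
  then obtain D where D: "regular_PDS G (8 * p ^ 3) k l m D" by blast
  interpret comm_group G by fact
  note sub = regular_PDS_D(3)[OF D]
  have odd_p: "odd p" using \<open>prime p\<close> \<open>p \<ge> 5\<close> by (intro prime_odd_nat) auto
  define h where "h = \<beta> div 2"
  have h: "h = 4 * y + 2 \<or> h = -4 * y - 3" "\<beta> = 2 * h"
    using assms(4) by (auto simp: h_def)
  \<comment> \<open>Both candidates for \<open>h\<close> are roots of this quadratic, which makes
    \<open>h + 2 p\<close> and \<open>h - 2 p\<close> the restricted eigenvalues.\<close>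
  from h(1) have "h * h = 4 * int p - 2 - h"
    unfolding assms(1) by (elim disjE; simp only:; simp add: algebra_simps power2_eq_square)
  then have rs: "(h + 2 * int p) + (h - 2 * int p) = int l - int m"
    "(h + 2 * int p) * (h - 2 * int p) = int m - int k"
    using assms(5-7) h(2) by (auto simp: algebra_simps power2_eq_square)
  have closed: "g [^]\<^bsub>G\<^esub> t \<in> D" if "g \<in> D" "coprime t (order G)" for g t
  proof -
    have t: "odd t" "coprime t p"
      using that(2) assms(10) by (auto simp: coprime_right_2_iff_odd)
    \<comment> \<open>The eigenvalues differ by \<open>4 p\<close>.\<close>
    then have "coprime (int t) (2 * 2 * int p)"
      unfolding coprime_mult_right_iff by (simp add: coprime_right_2_iff_odd)
    then show ?thesis
      using that t assms(10) by (intro regular_PDS_multiplier[OF D rs]) (auto simp: odd_pos)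
  qed
  define H where "H = {x \<in> carrier G. x [^]\<^bsub>G\<^esub> (8::nat) = \<one>\<^bsub>G\<^esub>}"
  define x where "x = card (D \<inter> H)"
  define Z where "Z = (\<lambda>x. x [^]\<^bsub>G\<^esub> (8::nat)) ` carrier G"
  define B where "B = fibre_size G 8 D"
  have card_H: "card H = 8"
    using card_prime_power_torsion[of 2 3 "p ^ 3"] assms(9,10) odd_p by (simp add: H_def)
  have "D \<inter> H \<subseteq> H - {\<one>\<^bsub>G\<^esub>}" "\<one>\<^bsub>G\<^esub> \<in> H" "finite H"
    using regular_PDS_D(6)[OF D] assms(9) by (auto simp: H_def)
  then have x_le: "x \<le> 7"
    using card_mono[of "H - {\<one>\<^bsub>G\<^esub>}" "D \<inter> H"] card_H by (simp add: x_def)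
  have order: "order G = 2 ^ 3 * p ^ Suc 2" using assms(10) by simp
  have dvd: "int (p - 1) dvd (\<Sum>z\<in>Z - {\<one>\<^bsub>G\<^esub>}. F (B z))" for F :: "nat \<Rightarrow> int"
    using dvd_sum_fibre_size[OF assms(9) sub \<open>prime p\<close> odd_p order closed, of F]
    by (simp add: Z_def B_def)
  have Z: "finite Z" "\<one>\<^bsub>G\<^esub> \<in> Z"
    using assms(9) by (auto simp: Z_def image_iff intro!: bexI[of _ "\<one>\<^bsub>G\<^esub>"])
  have "D \<inter> H = {g \<in> D. g [^]\<^bsub>G\<^esub> (8::nat) = \<one>\<^bsub>G\<^esub>}" using sub by (auto simp: H_def)
  then have B1: "B \<one>\<^bsub>G\<^esub> = x" by (simp add: B_def x_def fibre_size_def)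
  obtain a where a: "(\<Sum>z\<in>Z - {\<one>\<^bsub>G\<^esub>}. int (B z)) = int (p - 1) * a"
    using dvd[of int] by (elim dvdE)
  \<comment> \<open>Binomials instead of squares gain a factor 2: the sum of squares is fixed modulo
    \<open>2 (p - 1)\<close> by the sum of the \<open>B z\<close>. The final contradiction needs
    this factor.\<close>
  obtain b where b: "(\<Sum>z\<in>Z - {\<one>\<^bsub>G\<^esub>}. int (B z choose 2)) = int (p - 1) * b"
    using dvd[of "\<lambda>n. int (n choose 2)"] by (elim dvdE)
  have "int k = (\<Sum>z\<in>Z. int (B z))"
    using sum_fibre_size[OF assms(9) sub, of 8] regular_PDS_D(5)[OF D]
    by (simp add: Z_def B_def flip: of_nat_sum)
  then have first: "int k = int x + int (p - 1) * a"
    using sum.remove[OF Z, of "\<lambda>z. int (B z)"] a B1 by simp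
  have "(int n)\<^sup>2 = 2 * int (n choose 2) + int n" for n
  proof -
    have "2 dvd n * (n - 1)" by (cases n) auto
    then have "2 * (n choose 2) = n * (n - 1)" by (simp add: choose_two)
    then have "2 * (n choose 2) + n = n\<^sup>2" by (cases n) (auto simp: power2_eq_square)
    then show ?thesis by (metis of_nat_add of_nat_mult of_nat_numeral of_nat_power)
  qed
  then have "(\<Sum>z\<in>Z - {\<one>\<^bsub>G\<^esub>}. (int (B z))\<^sup>2) = 2 * (int (p - 1) * b) + int (p - 1) * a"
    by (simp add: sum.distrib a b flip: sum_distrib_left)
  moreover have "(\<Sum>z\<in>Z. (int (B z))\<^sup>2) = int k - int m + \<beta> * int x + 8 * int m"
    using regular_PDS_sum_fibre_size_square[OF D, of 8, folded H_def Z_def B_def x_def]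
      assms(6) card_H by simp
  ultimately have second: "int k - int m + \<beta> * int x + 8 * int m =
      (int x)\<^sup>2 + (2 * (int (p - 1) * b) + int (p - 1) * a)"
    using sum.remove[OF Z, of "\<lambda>z. (int (B z))\<^sup>2"] B1 by simp
  have y: "y \<ge> 1 \<or> y \<le> -3"
  proof (rule ccontr)
    assume "\<not> ?thesis"
    then have "y = 0 \<or> y = -1 \<or> y = -2" by auto
    with assms(1) have "p = 2 \<or> p = 1 \<or> p = 8" by auto
    with \<open>p \<ge> 5\<close> odd_p show False by auto
  qed
  define N where "N = int (p - 1)"
  have N: "N = int p - 1" using \<open>p \<ge> 5\<close> by (simp add: N_def)
  have Ny: "N = 4 * y\<^sup>2 + 5 * y + 1" using N assms(1) by simp
  \<comment> \<open>From \<open>k = (p - 1) (4 p + 2) + h + 2\<close>.\<close>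
  have res: "int x = h + 2 + N * (4 * int p + 2 - a)"
    using first assms(7) unfolding N_def[symmetric] h_def[symmetric] N
    by (simp add: algebra_simps power2_eq_square)
  have "h \<noteq> 4 * y + 2"
    using no_small_residue(1)[OF Ny y, of "int x" "4 * int p + 2 - a"] x_le res by auto
  then have h': "h = -4 * y - 3" using h(1) by blast
  then have "y = 1 \<and> int x = 5"
    using x_le res by (intro no_small_residue(2)[OF Ny y, where t = "4 * int p + 2 - a"]) auto
  then have "y = 1" "int x = 5" by blast+
  moreover have "int p = 11" using assms(1) \<open>y = 1\<close> by simp
  moreover have "h = -7" using h' \<open>y = 1\<close> by simp
  moreover have "int k = 455"
    using assms(7) unfolding h_def[symmetric] \<open>int p = 11\<close> \<open>h = -7\<close> by simp
  moreover have "int m = 20" using assms(5) \<open>int p = 11\<close> by simp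
  \<comment> \<open>Together these give \<open>20 * b = 50\<close>.\<close>
  ultimately have "450 = 10 * a" "500 = 20 * b + 10 * a"
    using first second h(2) N N_def by auto
  then show False by presburger
qed

end
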